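(* Let $k$ be a field, $\mathfrak{g}$ a nonzero Lie algebra over $k$, $E$ a vector space that contains $\mathfrak{g}$ as a subspace and $V$ a complement of $\mathfrak{g}$ in $E$. Then two Lie extending structures $\Omega(\mathfrak{g}, V)$ and $\Omega'(\mathfrak{g}, V)$ of $\mathfrak{g}$ through $V$ satisfy $\Omega(\mathfrak{g}, V) \approx \Omega'(\mathfrak{g}, V)$ if and only if there exists an isomorphism of Lie algebras $\psi: \mathfrak{g}\,\natural\, V \to \mathfrak{g}\,\natural\,' V$ between the associated unified products which stabilizes $\mathfrak{g}$ and co-stabilizes $V$. Consequently $\approx$ is an equivalence relation on the set $\mathcal{L}(\mathfrak{g}, V)$ of all Lie extending structures of $\mathfrak{g}$ through $V$ and, denoting $\mathcal{H}^{2}(V, \mathfrak{g}) := \mathcal{L}(\mathfrak{g}, V)/\approx$, the map $$\mathcal{H}^{2}(V, \mathfrak{g}) \to \mathrm{Extd}'(E, \mathfrak{g}), \qquad \overline{(\triangleleft, \triangleright, f, \{-,-\})} \mapsto \bigl(\mathfrak{g} \,\natural\, V, [-,-]\bigr)$$ is a bijection.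
   Context: All vector spaces, Lie algebras, linear and bilinear maps are over an arbitrary field $k$. A complement of $\mathfrak{g}$ in $E$ is a subspace $V$ with $E=\mathfrak{g}+V$ and $V\cap\mathfrak{g}=0$. Unified products. An extending datum of $\mathfrak{g}$ through $V$ is a system $\Omega(\mathfrak{g}, V) = (\triangleleft, \triangleright, f, \{-,-\})$ of four bilinear maps $\triangleleft : V \times \mathfrak{g} \to V$, $\triangleright : V \times \mathfrak{g} \to \mathfrak{g}$, $f : V\times V \to \mathfrak{g}$, $\{-,-\} : V\times V \to V$. It is a Lie extending structure if $\mathfrak{g}\times V$ is a Lie algebra with the bracket $$[(g, x), (h, y)] := \bigl([g, h] + x \triangleright h - y\triangleright g + f(x, y),\ \{x, y\} + x\triangleleft h - y\triangleleft g\bigr);$$ this Lie algebra is denoted $\mathfrak{g}\,\natural\, V$ (the unified product); $\mathfrak{g}\,\natural\,' V$ denotes the one associated to $\Omega'(\mathfrak{g},V)$. The relation $\approx$ on $\mathcal{L}(\mathfrak{g},V)$. $(\triangleleft, \triangleright, f, \{-,-\})\approx(\triangleleft', \triangleright', f', \{-,-\}')$ (cohomologous) if $\triangleleft'=\triangleleft$ and there exists a linear map $r: V\to\mathfrak{g}$ such that for all $g\in\mathfrak{g}$, $x,y\in V$: \begin{align*} x \triangleright' g &= x \triangleright g + r(x \triangleleft g) - [r(x), g],\\ f'(x, y) &= f(x, y) + r(\{x, y\}) + [r(x), r(y)] + y \triangleright r(x) - x \triangleright r(y) + r\bigl(y \triangleleft r(x)\bigr) - r\bigl(x \triangleleft r(y)\bigr),\\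 \{x, y\}' &= \{x, y\} - x \triangleleft r(y) + y \triangleleft r(x). \end{align*} Stabilizing. A linear map $\psi:\mathfrak{g}\,\natural\, V\to\mathfrak{g}\,\natural\,' V$ stabilizes $\mathfrak{g}$ if $\psi(g,0)=(g,0)$ for all $g\in\mathfrak{g}$, and co-stabilizes $V$ if the $V$-component of $\psi(g,x)$ is $x$ for all $(g,x)$. A linear map $\varphi:E\to E$ stabilizes $\mathfrak{g}$ if $\varphi(g)=g$ for all $g\in\mathfrak{g}$, and co-stabilizes $V$ if $\pi\circ\varphi=\pi$, where $\pi:E\to V$ is the projection along $\mathfrak{g}$. The set $\mathrm{Extd}'(E,\mathfrak{g})$. Two Lie algebra structures on $E$, both containing $\mathfrak{g}$ as a Lie subalgebra, are cohomologous if there is a Lie algebra isomorphism from $E$ with the first structure to $E$ with the second that stabilizes $\mathfrak{g}$ and co-stabilizes $V$. $\mathrm{Extd}'(E,\mathfrak{g})$ is the set of equivalence classes of this relation. In the displayed map, $(\mathfrak{g}\,\natural\, V,[-,-])$ denotes the class of the Lie algebra structure on $E$ obtained by transporting the bracket of $\mathfrak{g}\,\natural\, V$ along the linear isomorphism $\mathfrak{g}\times V\to E$, $(g,x)\mapsto g+x$. *)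

theory Defs
  imports "HOL-Analysis.Product_Vector" "HOL-Library.FuncSet"
begin

section \<open>Linear maps and Lie algebras on a carrier\<close>

definition linear_on ::
    "('k::field \<Rightarrow> 'a::ab_group_add \<Rightarrow> 'a) \<Rightarrow> 'a set \<Rightarrow>
     ('k \<Rightarrow> 'b::ab_group_add \<Rightarrow> 'b) \<Rightarrow> 'b set \<Rightarrow> ('a \<Rightarrow> 'b) \<Rightarrow> bool" where
  "linear_on s1 A s2 B f \<longleftrightarrow>
     f \<in> A \<rightarrow> B \<and>
     (\<forall>x\<in>A. \<forall>y\<in>A. f (x + y) = f x + f y) \<and>
     (\<forall>c. \<forall>x\<in>A. f (s1 c x) = s2 c (f x))"

definition bilinear_on ::
    "('k::field \<Rightarrow> 'a::ab_group_add \<Rightarrow> 'a) \<Rightarrow> 'a set \<Rightarrow> 'a set \<Rightarrow> 'a set \<Rightarrow>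
     ('a \<Rightarrow> 'a \<Rightarrow> 'a) \<Rightarrow> bool" where
  "bilinear_on s A B C b \<longleftrightarrow>
     (\<forall>x\<in>A. linear_on s B s C (\<lambda>y. b x y)) \<and>
     (\<forall>y\<in>B. linear_on s A s C (\<lambda>x. b x y))"

text \<open>The field is arbitrary, so the bracket is required to be alternating, not merely
  antisymmetric.\<close>

definition lie_algebra_on ::
    "('k::field \<Rightarrow> 'a::ab_group_add \<Rightarrow> 'a) \<Rightarrow> 'a set \<Rightarrow> ('a \<Rightarrow> 'a \<Rightarrow> 'a) \<Rightarrow> bool" where
  "lie_algebra_on s L b \<longleftrightarrow>
     vector_space s \<and> module.subspace s L \<and>
     bilinear_on s L L L b \<and>
     (\<forall>x\<in>L. b x x = 0) \<and>
     (\<forall>x\<in>L. \<forall>y\<in>L. \<forall>z\<in>L. b x (b y z) + b y (b z x) + b z (b x y) = 0)"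

definition lie_iso_on ::
    "('k::field \<Rightarrow> 'a::ab_group_add \<Rightarrow> 'a) \<Rightarrow> 'a set \<Rightarrow> ('a \<Rightarrow> 'a \<Rightarrow> 'a) \<Rightarrow>
     ('k \<Rightarrow> 'b::ab_group_add \<Rightarrow> 'b) \<Rightarrow> 'b set \<Rightarrow> ('b \<Rightarrow> 'b \<Rightarrow> 'b) \<Rightarrow> ('a \<Rightarrow> 'b) \<Rightarrow> bool" where
  "lie_iso_on s1 A b1 s2 B b2 f \<longleftrightarrow>
     linear_on s1 A s2 B f \<and> bij_betw f A B \<and>
     (\<forall>x\<in>A. \<forall>y\<in>A. f (b1 x y) = b2 (f x) (f y))"

text \<open>The vector space \<open>E\<close> is the whole type; the Lie algebra \<open>g\<close> and \<open>V\<close> are subsets of it.\<close>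

definition complement_of ::
    "('k::field \<Rightarrow> 'e::ab_group_add \<Rightarrow> 'e) \<Rightarrow> 'e set \<Rightarrow> 'e set \<Rightarrow> bool" where
  "complement_of s g V \<longleftrightarrow>
     module.subspace s V \<and> {a + x | a x. a \<in> g \<and> x \<in> V} = UNIV \<and> V \<inter> g = {0}"


section \<open>Extending structures and unified products\<close>

text \<open>\<open>ract\<close>, \<open>lact\<close>, \<open>cocyc\<close>, \<open>vbr\<close> are \<open>\<triangleleft>\<close>, \<open>\<triangleright>\<close>, \<open>f\<close>, \<open>{-,-}\<close>.\<close>

record 'e extdatum =
  ract :: "'e \<Rightarrow> 'e \<Rightarrow> 'e"
  lact :: "'e \<Rightarrow> 'e \<Rightarrow> 'e"
  cocyc :: "'e \<Rightarrow> 'e \<Rightarrow> 'e"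
  vbr :: "'e \<Rightarrow> 'e \<Rightarrow> 'e"

text \<open>The four maps are extensional (\<open>undefined\<close> off their domains), so that equality of
  data is equality of the four maps on their domains.\<close>

definition extending_datum ::
    "('k::field \<Rightarrow> 'e::ab_group_add \<Rightarrow> 'e) \<Rightarrow> 'e set \<Rightarrow> 'e set \<Rightarrow> 'e extdatum \<Rightarrow> bool" where
  "extending_datum s g V \<Omega> \<longleftrightarrow>
     bilinear_on s V g V (ract \<Omega>) \<and> case_prod (ract \<Omega>) \<in> extensional (V \<times> g) \<and>
     bilinear_on s V g g (lact \<Omega>) \<and> case_prod (lact \<Omega>) \<in> extensional (V \<times> g) \<and>
     bilinear_on s V V g (cocyc \<Omega>) \<and> case_prod (cocyc \<Omega>) \<in> extensional (V \<times> V) \<and>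
     bilinear_on s V V V (vbr \<Omega>) \<and> case_prod (vbr \<Omega>) \<in> extensional (V \<times> V)"

definition unified_bracket ::
    "('e::ab_group_add \<Rightarrow> 'e \<Rightarrow> 'e) \<Rightarrow> 'e extdatum \<Rightarrow> 'e \<times> 'e \<Rightarrow> 'e \<times> 'e \<Rightarrow> 'e \<times> 'e" where
  "unified_bracket br \<Omega> = (\<lambda>(a, x) (b, y).
     (br a b + lact \<Omega> x b - lact \<Omega> y a + cocyc \<Omega> x y,
      vbr \<Omega> x y + ract \<Omega> x b - ract \<Omega> y a))"

definition lie_extending_structures ::
    "('k::field \<Rightarrow> 'e::ab_group_add \<Rightarrow> 'e) \<Rightarrow> 'e set \<Rightarrow> ('e \<Rightarrow> 'e \<Rightarrow> 'e) \<Rightarrow> 'e set \<Rightarrow>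
     'e extdatum set" where
  "lie_extending_structures s g br V =
     {\<Omega>. extending_datum s g V \<Omega> \<and>
         lie_algebra_on (module_prod.scale s s) (g \<times> V) (unified_bracket br \<Omega>)}"

definition cohomologous ::
    "('k::field \<Rightarrow> 'e::ab_group_add \<Rightarrow> 'e) \<Rightarrow> 'e set \<Rightarrow> ('e \<Rightarrow> 'e \<Rightarrow> 'e) \<Rightarrow> 'e set \<Rightarrow>
     'e extdatum \<Rightarrow> 'e extdatum \<Rightarrow> bool" where
  "cohomologous s g br V \<Omega> \<Omega>' \<longleftrightarrow>
     ract \<Omega>' = ract \<Omega> \<and>
     (\<exists>r. linear_on s V s g r \<and>
       (\<forall>a\<in>g. \<forall>x\<in>V. lact \<Omega>' x a = lact \<Omega> x a + r (ract \<Omega> x a) - br (r x) a) \<and>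
       (\<forall>x\<in>V. \<forall>y\<in>V. cocyc \<Omega>' x y =
          cocyc \<Omega> x y + r (vbr \<Omega> x y) + br (r x) (r y)
          + lact \<Omega> y (r x) - lact \<Omega> x (r y)
          + r (ract \<Omega> y (r x)) - r (ract \<Omega> x (r y))) \<and>
       (\<forall>x\<in>V. \<forall>y\<in>V. vbr \<Omega>' x y =
          vbr \<Omega> x y - ract \<Omega> x (r y) + ract \<Omega> y (r x)))"

definition cohomologous_rel ::
    "('k::field \<Rightarrow> 'e::ab_group_add \<Rightarrow> 'e) \<Rightarrow> 'e set \<Rightarrow> ('e \<Rightarrow> 'e \<Rightarrow> 'e) \<Rightarrow> 'e set \<Rightarrow>
     ('e extdatum \<times> 'e extdatum) set" where
  "cohomologous_rel s g br V =
     {(\<Omega>, \<Omega>'). \<Omega> \<in> lie_extending_structures s g br V \<and>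
              \<Omega>' \<in> lie_extending_structures s g br V \<and> cohomologous s g br V \<Omega> \<Omega>'}"

definition H2 ::
    "('k::field \<Rightarrow> 'e::ab_group_add \<Rightarrow> 'e) \<Rightarrow> 'e set \<Rightarrow> ('e \<Rightarrow> 'e \<Rightarrow> 'e) \<Rightarrow> 'e set \<Rightarrow>
     'e extdatum set set" where
  "H2 s g br V = lie_extending_structures s g br V // cohomologous_rel s g br V"

definition stabilizes_prod :: "'e::ab_group_add set \<Rightarrow> ('e \<times> 'e \<Rightarrow> 'e \<times> 'e) \<Rightarrow> bool" where
  "stabilizes_prod g \<psi> \<longleftrightarrow> (\<forall>a\<in>g. \<psi> (a, 0) = (a, 0))"

definition costabilizes_prod :: "'e set \<Rightarrow> 'e set \<Rightarrow> ('e \<times> 'e \<Rightarrow> 'e \<times> 'e) \<Rightarrow> bool" where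
  "costabilizes_prod g V \<psi> \<longleftrightarrow> (\<forall>a\<in>g. \<forall>x\<in>V. snd (\<psi> (a, x)) = x)"


section \<open>Lie algebra structures on \<open>E\<close>\<close>

definition recompose :: "'e::ab_group_add \<times> 'e \<Rightarrow> 'e" where
  "recompose = (\<lambda>(a, x). a + x)"

definition decompose :: "'e::ab_group_add set \<Rightarrow> 'e set \<Rightarrow> 'e \<Rightarrow> 'e \<times> 'e" where
  "decompose g V = the_inv_into (g \<times> V) recompose"

definition proj_along :: "'e::ab_group_add set \<Rightarrow> 'e set \<Rightarrow> 'e \<Rightarrow> 'e" where
  "proj_along g V e = snd (decompose g V e)"

text \<open>Since \<open>g\<close> is already a subspace, being a Lie subalgebra means that the new bracket
  extends the given one.\<close>

definition lie_structures ::
    "('k::field \<Rightarrow> 'e::ab_group_add \<Rightarrow> 'e) \<Rightarrow> 'e set \<Rightarrow> ('e \<Rightarrow> 'e \<Rightarrow> 'e) \<Rightarrow>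
     ('e \<Rightarrow> 'e \<Rightarrow> 'e) set" where
  "lie_structures s g br =
     {B. lie_algebra_on s UNIV B \<and> (\<forall>a\<in>g. \<forall>b\<in>g. B a b = br a b)}"

definition lie_structures_rel ::
    "('k::field \<Rightarrow> 'e::ab_group_add \<Rightarrow> 'e) \<Rightarrow> 'e set \<Rightarrow> ('e \<Rightarrow> 'e \<Rightarrow> 'e) \<Rightarrow> 'e set \<Rightarrow>
     (('e \<Rightarrow> 'e \<Rightarrow> 'e) \<times> ('e \<Rightarrow> 'e \<Rightarrow> 'e)) set" where
  "lie_structures_rel s g br V =
     {(B, B'). B \<in> lie_structures s g br \<and> B' \<in> lie_structures s g br \<and>
        (\<exists>\<phi>. lie_iso_on s UNIV B s UNIV B' \<phi> \<and>
             (\<forall>a\<in>g. \<phi> a = a) \<and> proj_along g V \<circ> \<phi> = proj_along g V)}"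

definition Extd' ::
    "('k::field \<Rightarrow> 'e::ab_group_add \<Rightarrow> 'e) \<Rightarrow> 'e set \<Rightarrow> ('e \<Rightarrow> 'e \<Rightarrow> 'e) \<Rightarrow> 'e set \<Rightarrow>
     ('e \<Rightarrow> 'e \<Rightarrow> 'e) set set" where
  "Extd' s g br V = lie_structures s g br // lie_structures_rel s g br V"

definition transported_bracket ::
    "'e::ab_group_add set \<Rightarrow> ('e \<Rightarrow> 'e \<Rightarrow> 'e) \<Rightarrow> 'e set \<Rightarrow> 'e extdatum \<Rightarrow> 'e \<Rightarrow> 'e \<Rightarrow> 'e" where
  "transported_bracket g br V \<Omega> e e' =
     recompose (unified_bracket br \<Omega> (decompose g V e) (decompose g V e'))"

text \<open>Image of a class: the union of the classes attached to its members. That this is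
  the class attached to any one member is part of what has to be proved.\<close>

definition unified_class_map ::
    "('k::field \<Rightarrow> 'e::ab_group_add \<Rightarrow> 'e) \<Rightarrow> 'e set \<Rightarrow> ('e \<Rightarrow> 'e \<Rightarrow> 'e) \<Rightarrow> 'e set \<Rightarrow>
     'e extdatum set \<Rightarrow> ('e \<Rightarrow> 'e \<Rightarrow> 'e) set" where
  "unified_class_map s g br V C =
     (\<Union>\<Omega>\<in>C. lie_structures_rel s g br V `` {transported_bracket g br V \<Omega>})"

text \<open>Sanity checks: the projection is well defined, and the relation defining \<open>Extd'\<close> is an
  equivalence.\<close>

lemma bij_recompose:
  fixes s :: "'k::field \<Rightarrow> 'e::ab_group_add \<Rightarrow> 'e"
  assumes "vector_space s" "module.subspace s g" "complement_of s g V"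
  shows "bij_betw recompose (g \<times> V) UNIV"
proof -
  interpret vector_space s by fact
  have V: "subspace V" and sum: "{a + x | a x. a \<in> g \<and> x \<in> V} = UNIV" and int: "V \<inter> g = {0}"
    using assms(3) by (auto simp: complement_of_def)
  have "a = b \<and> x = y" if "a \<in> g" "b \<in> g" "x \<in> V" "y \<in> V" "a + x = b + y" for a b x y
  proof -
    have e: "a - b = y - x" using that(5) by (simp add: algebra_simps)
    have "a - b \<in> g" "y - x \<in> V"
      using that V assms(2) subspace_diff by blast+
    then have "a - b \<in> V \<inter> g" using e by auto
    then show ?thesis using e int by auto
  qed
  then have "inj_on recompose (g \<times> V)"
    by (auto simp: inj_on_def recompose_def)
  moreover have "recompose ` (g \<times> V) = UNIV"
    using sum by (force simp: recompose_def image_def)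
  ultimately show ?thesis by (simp add: bij_betw_def)
qed

lemma equiv_lie_structures_rel:
  "equiv (lie_structures s g br) (lie_structures_rel s g br V)"
proof (rule equivI)
  show "lie_structures_rel s g br V \<subseteq> lie_structures s g br \<times> lie_structures s g br"
    by (auto simp: lie_structures_rel_def)
  have "lie_iso_on s UNIV B s UNIV B id" for B
    by (auto simp: lie_iso_on_def linear_on_def)
  then show "refl_on (lie_structures s g br) (lie_structures_rel s g br V)"
    unfolding refl_on_def lie_structures_rel_def
    by (auto intro!: exI[of _ id])
  show "sym (lie_structures_rel s g br V)"
  proof (rule symI)
    fix B B' assume "(B, B') \<in> lie_structures_rel s g br V"
    then obtain \<phi> where B: "B \<in> lie_structures s g br" "B' \<in> lie_structures s g br"
      and iso: "lie_iso_on s UNIV B s UNIV B' \<phi>"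
      and st: "\<forall>a\<in>g. \<phi> a = a" and co: "proj_along g V \<circ> \<phi> = proj_along g V"
      by (auto simp: lie_structures_rel_def)
    have bij: "bij \<phi>" using iso by (simp add: lie_iso_on_def)
    have i: "inv \<phi> (\<phi> x) = x" "\<phi> (inv \<phi> x) = x" for x
      using bij by (simp_all add: bij_is_inj bij_is_surj surj_f_inv_f)
    have eqI: "inv \<phi> x = y" if "x = \<phi> y" for x y using that i by simp
    have "lie_iso_on s UNIV B' s UNIV B (inv \<phi>)"
      using iso bij bij_imp_bij_inv[OF bij] unfolding lie_iso_on_def linear_on_def
      by (auto intro!: eqI simp: i)
    moreover have "\<forall>a\<in>g. inv \<phi> a = a" using st by (auto intro!: eqI)
    moreover have "proj_along g V \<circ> inv \<phi> = proj_along g V"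
      using co i by (metis comp_apply ext)
    ultimately show "(B', B) \<in> lie_structures_rel s g br V"
      using B by (auto simp: lie_structures_rel_def)
  qed
  show "trans (lie_structures_rel s g br V)"
  proof (rule transI)
    fix B B' B''
    assume "(B, B') \<in> lie_structures_rel s g br V" "(B', B'') \<in> lie_structures_rel s g br V"
    then obtain \<phi> \<chi> where B: "B \<in> lie_structures s g br" "B'' \<in> lie_structures s g br"
      and 1: "lie_iso_on s UNIV B s UNIV B' \<phi>" "\<forall>a\<in>g. \<phi> a = a"
        "proj_along g V \<circ> \<phi> = proj_along g V"
      and 2: "lie_iso_on s UNIV B' s UNIV B'' \<chi>" "\<forall>a\<in>g. \<chi> a = a"
        "proj_along g V \<circ> \<chi> = proj_along g V"
      by (auto simp: lie_structures_rel_def)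
    have "lie_iso_on s UNIV B s UNIV B'' (\<chi> \<circ> \<phi>)"
      using 1(1) 2(1) unfolding lie_iso_on_def linear_on_def
      by (auto intro: bij_comp)
    moreover have "proj_along g V \<circ> (\<chi> \<circ> \<phi>) = proj_along g V"
      using 1(3) 2(3) by (simp add: comp_assoc[symmetric])
    ultimately show "(B, B'') \<in> lie_structures_rel s g br V"
      using B 1(2) 2(2) by (auto simp: lie_structures_rel_def intro!: exI[of _ "\<chi> \<circ> \<phi>"])
  qed
qed

end

theory Submission
  imports Defs
begin

text \<open>
  A linear map of \<open>g \<times> V\<close> that stabilizes \<open>g\<close> and co-stabilizes \<open>V\<close> is forced to be a shear
  \<open>(a, x) \<mapsto> (a + r x, x)\<close> with \<open>r : V \<rightarrow> g\<close> linear, and every shear is bijective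
  (\<open>stabilizing_map_is_shear\<close>, \<open>shear_bij\<close>). Comparing brackets of the generators \<open>(a, 0)\<close> and
  \<open>(0, x)\<close>, a shear carries one unified bracket to another precisely when \<open>r\<close> satisfies the
  identities that define cohomologous data (\<open>shear_multiplicative_iff\<close>). This is the criterion.

  The rest is formal. By construction \<open>(a, x) \<mapsto> a + x\<close> is a Lie isomorphism from the unified
  product onto \<open>E\<close> with the transported bracket. Conjugating with it turns isomorphisms of
  unified products that stabilize \<open>g\<close> and co-stabilize \<open>V\<close> into isomorphisms of structures
  on \<open>E\<close> with the same two properties, so that being cohomologous is the pullback, along
  \<open>\<Omega> \<mapsto> transported_bracket g br V \<Omega>\<close>, of the equivalence relation on Lie structures on \<open>E\<close>
  (\<open>cohomologous_rel_eq_pullback\<close>). This map is onto the Lie structures on \<open>E\<close> that extend the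
  bracket of \<open>g\<close> (\<open>transported_bracket_surj\<close>): such a bracket is recovered from the
  bracket of \<open>g\<close> and the \<open>g\<close>- and \<open>V\<close>-components of its values on \<open>V \<times> g\<close> and
  \<open>V \<times> V\<close>. The pullback of
  an equivalence relation along a surjection is an equivalence relation with the same quotient.
\<close>

section \<open>Quotients by a relation pulled back along a surjection\<close>

context
  fixes S :: "'b set" and R :: "('b \<times> 'b) set" and L :: "'a set" and T :: "'a \<Rightarrow> 'b"
    and R' :: "('a \<times> 'a) set"
  assumes R: "equiv S R" and surj: "T ` L = S"
    and R': "R' = {(x, y). x \<in> L \<and> y \<in> L \<and> (T x, T y) \<in> R}"
begin

lemma equiv_pullback: "equiv L R'"
proof (rule equivI)
  show "R' \<subseteq> L \<times> L" using R' by auto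
  show "refl_on L R'"
    using R surj by (auto simp: R' equiv_def refl_on_def)
  show "sym R'"
    using R by (auto simp: R' equiv_def sym_def)
  show "trans R'"
    using R unfolding R' equiv_def trans_def by blast
qed

text \<open>The map \<open>T\<close> sends related elements to related elements, so every member of a class
  contributes the same set to the union.\<close>

lemma pullback_class_map:
  assumes "x \<in> L"
  shows "(\<Union>y\<in>R' `` {x}. R `` {T y}) = R `` {T x}"
proof -
  have "R `` {T y} = R `` {T x}" if "y \<in> R' `` {x}" for y
    using equiv_class_eq[OF R, of "T x" "T y"] that by (simp add: R')
  moreover have "x \<in> R' `` {x}"
    using equiv_class_self[OF equiv_pullback assms] .
  ultimately show ?thesis by blast
qed

lemma bij_betw_pullback_quotient: "bij_betw (\<lambda>C. \<Union>y\<in>C. R `` {T y}) (L // R') (S // R)"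
proof (rule bij_betw_imageI)
  show "inj_on (\<lambda>C. \<Union>y\<in>C. R `` {T y}) (L // R')"
  proof (rule inj_onI)
    fix C D assume C: "C \<in> L // R'" and D: "D \<in> L // R'"
      and eq: "(\<Union>y\<in>C. R `` {T y}) = (\<Union>y\<in>D. R `` {T y})"
    obtain x y where xy: "x \<in> L" "C = R' `` {x}" "y \<in> L" "D = R' `` {y}"
      using C D by (auto elim!: quotientE)
    then have "R `` {T x} = R `` {T y}"
      using eq by (simp add: pullback_class_map)
    moreover have "T y \<in> S" using surj xy by auto
    ultimately have "(T x, T y) \<in> R" using eq_equiv_class[OF _ R] by blast
    then show "C = D"
      using xy equiv_class_eq[OF equiv_pullback, of x y] by (simp add: R')
  qed
  have "(\<lambda>C. \<Union>y\<in>C. R `` {T y}) ` (L // R') = (\<lambda>x. R `` {T x}) ` L"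
    by (auto simp: quotient_def image_UN pullback_class_map simp flip: image_image)
  then show "(\<lambda>C. \<Union>y\<in>C. R `` {T y}) ` (L // R') = S // R"
    using surj by (auto simp: quotient_def)
qed

end

section \<open>Linear maps and Lie isomorphisms on carriers\<close>

lemma linear_onD:
  assumes "linear_on s1 A s2 B f"
  shows "x \<in> A \<Longrightarrow> f x \<in> B"
    and "x \<in> A \<Longrightarrow> y \<in> A \<Longrightarrow> f (x + y) = f x + f y"
    and "x \<in> A \<Longrightarrow> f (s1 c x) = s2 c (f x)"
  using assms by (auto simp: linear_on_def)

lemma linear_on_0:
  assumes "linear_on s1 A s2 B f" "0 \<in> A"
  shows "f 0 = 0"
  using linear_onD(2)[OF assms(1), of 0 0] assms(2) by simp

lemma linear_on_diff:
  assumes "linear_on s1 A s2 B f" "x \<in> A" "y \<in> A" "x - y \<in> A"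
  shows "f (x - y) = f x - f y"
  using linear_onD(2)[OF assms(1), of "x - y" y] assms(2-4) by (simp add: algebra_simps)

lemma linear_on_comp:
  assumes "linear_on s1 A s2 B f" "linear_on s2 B s3 C h"
  shows "linear_on s1 A s3 C (h \<circ> f)"
  using assms by (auto simp: linear_on_def Pi_iff)

lemma bilinear_onD:
  assumes "bilinear_on s A B C b"
  shows "x \<in> A \<Longrightarrow> y \<in> B \<Longrightarrow> b x y \<in> C"
    and "x \<in> A \<Longrightarrow> y \<in> B \<Longrightarrow> z \<in> B \<Longrightarrow> b x (y + z) = b x y + b x z"
    and "x \<in> A \<Longrightarrow> w \<in> A \<Longrightarrow> y \<in> B \<Longrightarrow> b (x + w) y = b x y + b w y"
    and "0 \<in> B \<Longrightarrow> x \<in> A \<Longrightarrow> b x 0 = 0"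
    and "0 \<in> A \<Longrightarrow> y \<in> B \<Longrightarrow> b 0 y = 0"
  using assms linear_on_0[of s B s C "b x"] linear_on_0[of s A s C "\<lambda>x. b x y"]
  by (auto simp: bilinear_on_def linear_on_def)

lemma lie_algebra_on_anticomm:
  assumes "lie_algebra_on s L b" "x \<in> L" "y \<in> L"
  shows "b x y = - b y x"
proof -
  interpret vector_space s using assms(1) by (simp add: lie_algebra_on_def)
  have b: "bilinear_on s L L L b" and alt: "\<And>z. z \<in> L \<Longrightarrow> b z z = 0" and L: "subspace L"
    using assms(1) by (auto simp: lie_algebra_on_def)
  have "0 = b (x + y) (x + y)" using alt subspace_add[OF L] assms by simp
  also have "\<dots> = b x y + b y x"
    using bilinear_onD(2,3)[OF b] alt[of x] alt[of y] assms(2,3) subspace_add[OF L] by simp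
  finally show ?thesis by (simp add: eq_neg_iff_add_eq_0)
qed

lemma lie_iso_on_comp:
  assumes "lie_iso_on s1 A b1 s2 B b2 f" "lie_iso_on s2 B b2 s3 C b3 h"
  shows "lie_iso_on s1 A b1 s3 C b3 (h \<circ> f)"
  using assms linear_on_comp[of s1 A s2 B f s3 C h] bij_betw_trans[of f A B h C]
    linear_onD(1)[of s1 A s2 B f]
  by (auto simp: lie_iso_on_def)

lemma lie_iso_on_the_inv_into:
  assumes f: "lie_iso_on s1 A b1 s2 B b2 f"
    and add: "\<And>x y. x \<in> A \<Longrightarrow> y \<in> A \<Longrightarrow> x + y \<in> A"
    and scale: "\<And>c x. x \<in> A \<Longrightarrow> s1 c x \<in> A"
    and br: "\<And>x y. x \<in> A \<Longrightarrow> y \<in> A \<Longrightarrow> b1 x y \<in> A"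
  shows "lie_iso_on s2 B b2 s1 A b1 (the_inv_into A f)"
proof -
  have lin: "linear_on s1 A s2 B f" and bij: "bij_betw f A B"
    and hom: "\<And>x y. x \<in> A \<Longrightarrow> y \<in> A \<Longrightarrow> f (b1 x y) = b2 (f x) (f y)"
    using f by (auto simp: lie_iso_on_def)
  have B: "B = f ` A" using bij by (simp add: bij_betw_def)
  have inv: "the_inv_into A f (f x) = x" if "x \<in> A" for x
    using bij that by (simp add: bij_betw_def the_inv_into_f_f)
  have inv_add: "the_inv_into A f (f x + f y) = x + y" if "x \<in> A" "y \<in> A" for x y
    using inv[OF add[OF that]] linear_onD(2)[OF lin that] by simp
  have inv_scale: "the_inv_into A f (s2 c (f x)) = s1 c x" if "x \<in> A" for c x
    using inv[OF scale[OF that]] linear_onD(3)[OF lin that] by simp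
  have inv_br: "the_inv_into A f (b2 (f x) (f y)) = b1 x y" if "x \<in> A" "y \<in> A" for x y
    using inv[OF br[OF that]] hom[OF that] by simp
  show ?thesis
    using bij_betw_the_inv_into[OF bij]
    by (auto simp: lie_iso_on_def linear_on_def B inv inv_add inv_scale inv_br)
qed

text \<open>Only the linear structure of the target is assumed: along a bijection, the Lie axioms
  of the target bracket are those of the source.\<close>

lemma lie_algebra_on_transport:
  assumes f: "lie_iso_on s1 A b1 s2 B b2 f" and A: "lie_algebra_on s1 A b1"
    and s2: "vector_space s2" "module.subspace s2 B"
  shows "lie_algebra_on s2 B b2"
proof -
  interpret v1: vector_space s1 using A by (simp add: lie_algebra_on_def)
  interpret v2: vector_space s2 by fact
  have lin: "linear_on s1 A s2 B f" and bij: "bij_betw f A B"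
    and hom: "\<And>x y. x \<in> A \<Longrightarrow> y \<in> A \<Longrightarrow> b2 (f x) (f y) = f (b1 x y)"
    using f by (auto simp: lie_iso_on_def)
  have B: "B = f ` A" using bij by (simp add: bij_betw_def)
  have sub: "v1.subspace A" and bil: "bilinear_on s1 A A A b1"
    and alt: "\<And>x. x \<in> A \<Longrightarrow> b1 x x = 0"
    and jac: "\<And>x y z. x \<in> A \<Longrightarrow> y \<in> A \<Longrightarrow> z \<in> A \<Longrightarrow>
      b1 x (b1 y z) + b1 y (b1 z x) + b1 z (b1 x y) = 0"
    using A by (auto simp: lie_algebra_on_def)
  note mem = v1.subspace_add[OF sub] v1.subspace_scale[OF sub] v1.subspace_0[OF sub]
    bilinear_onD(1)[OF bil]
  note lin_simps = linear_onD(2,3)[OF lin, symmetric] linear_on_0[OF lin]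
  have f_mem: "f x \<in> f ` A" if "x \<in> A" for x using that by blast
  have scale: "b1 x (s1 c y) = s1 c (b1 x y)" "b1 (s1 c x) y = s1 c (b1 x y)"
    if "x \<in> A" "y \<in> A" for c x y
    using bil that by (auto simp: bilinear_on_def linear_on_def)
  have "bilinear_on s2 B B B b2"
    unfolding bilinear_on_def linear_on_def B
    by (auto simp: lin_simps hom mem f_mem scale bilinear_onD(2,3)[OF bil])
  moreover have "b2 x x = 0" if "x \<in> B" for x
    using that by (auto simp: B hom alt lin_simps mem)
  moreover have "b2 x (b2 y z) + b2 y (b2 z x) + b2 z (b2 x y) = 0"
    if "x \<in> B" "y \<in> B" "z \<in> B" for x y z
    using that by (auto simp: B hom mem lin_simps jac)
  ultimately show ?thesis using s2 by (simp add: lie_algebra_on_def)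
qed

section \<open>Shears of a unified product\<close>

definition shear :: "('e::ab_group_add \<Rightarrow> 'e) \<Rightarrow> 'e \<times> 'e \<Rightarrow> 'e \<times> 'e" where
  "shear r = (\<lambda>(a, x). (a + r x, x))"

text \<open>The witness \<open>r\<close> of \<open>cohomologous\<close> is made a parameter here, so that the identities can
  be matched with one given shear.\<close>

definition cohomologous_via ::
    "'e::ab_group_add set \<Rightarrow> ('e \<Rightarrow> 'e \<Rightarrow> 'e) \<Rightarrow> 'e set \<Rightarrow> ('e \<Rightarrow> 'e) \<Rightarrow>
     'e extdatum \<Rightarrow> 'e extdatum \<Rightarrow> bool" where
  "cohomologous_via g br V r \<Omega> \<Omega>' \<longleftrightarrow>
     ract \<Omega>' = ract \<Omega> \<and>
     (\<forall>a\<in>g. \<forall>x\<in>V. lact \<Omega>' x a = lact \<Omega> x a + r (ract \<Omega> x a) - br (r x) a) \<and>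
     (\<forall>x\<in>V. \<forall>y\<in>V. cocyc \<Omega>' x y =
        cocyc \<Omega> x y + r (vbr \<Omega> x y) + br (r x) (r y)
        + lact \<Omega> y (r x) - lact \<Omega> x (r y)
        + r (ract \<Omega> y (r x)) - r (ract \<Omega> x (r y))) \<and>
     (\<forall>x\<in>V. \<forall>y\<in>V. vbr \<Omega>' x y =
        vbr \<Omega> x y - ract \<Omega> x (r y) + ract \<Omega> y (r x))"

lemma cohomologous_iff_via:
  "cohomologous s g br V \<Omega> \<Omega>' \<longleftrightarrow>
     (\<exists>r. linear_on s V s g r \<and> cohomologous_via g br V r \<Omega> \<Omega>')"
  by (auto simp: cohomologous_def cohomologous_via_def)

locale complemented_lie_algebra = vector_space s
  for s :: "'k::field \<Rightarrow> 'e::ab_group_add \<Rightarrow> 'e" +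
  fixes g :: "'e set" and br :: "'e \<Rightarrow> 'e \<Rightarrow> 'e" and V :: "'e set"
  assumes lie: "lie_algebra_on s g br" and complement: "complement_of s g V"
begin

sublocale vector_space_prod s s by unfold_locales

abbreviation sP :: "'k \<Rightarrow> 'e \<times> 'e \<Rightarrow> 'e \<times> 'e" where
  "sP \<equiv> module_prod.scale s s"

abbreviation unified_iso where
  "unified_iso \<Omega> \<Omega>' \<psi> \<equiv>
     lie_iso_on sP (g \<times> V) (unified_bracket br \<Omega>) sP (g \<times> V) (unified_bracket br \<Omega>') \<psi> \<and>
     stabilizes_prod g \<psi> \<and> costabilizes_prod g V \<psi>"

lemma subspace_g: "subspace g" and br_bilinear: "bilinear_on s g g g br"
  using lie by (auto simp: lie_algebra_on_def)

lemma subspace_V: "subspace V"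
  using complement by (simp add: complement_of_def)

lemmas mem_simps =
  subspace_add[OF subspace_g] subspace_diff[OF subspace_g] subspace_0[OF subspace_g]
  subspace_scale[OF subspace_g]
  subspace_add[OF subspace_V] subspace_diff[OF subspace_V] subspace_0[OF subspace_V]
  subspace_scale[OF subspace_V]

lemmas br_simps = bilinear_onD[OF br_bilinear]

lemma extending_datumD:
  assumes "extending_datum s g V \<Omega>"
  shows "bilinear_on s V g V (ract \<Omega>)" "bilinear_on s V g g (lact \<Omega>)"
    "bilinear_on s V V g (cocyc \<Omega>)" "bilinear_on s V V V (vbr \<Omega>)"
  using assms by (auto simp: extending_datum_def)

lemmas datum_simps =
  extending_datumD(1)[THEN bilinear_onD(1)] extending_datumD(1)[THEN bilinear_onD(2)]
  extending_datumD(1)[THEN bilinear_onD(4)] extending_datumD(1)[THEN bilinear_onD(5)]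
  extending_datumD(2)[THEN bilinear_onD(1)] extending_datumD(2)[THEN bilinear_onD(2)]
  extending_datumD(2)[THEN bilinear_onD(4)] extending_datumD(2)[THEN bilinear_onD(5)]
  extending_datumD(3)[THEN bilinear_onD(1)]
  extending_datumD(3)[THEN bilinear_onD(4)] extending_datumD(3)[THEN bilinear_onD(5)]
  extending_datumD(4)[THEN bilinear_onD(1)]
  extending_datumD(4)[THEN bilinear_onD(4)] extending_datumD(4)[THEN bilinear_onD(5)]

lemma unified_bracket_mem:
  assumes "extending_datum s g V \<Omega>" "p \<in> g \<times> V" "q \<in> g \<times> V"
  shows "unified_bracket br \<Omega> p q \<in> g \<times> V"
  using assms by (auto simp: unified_bracket_def datum_simps br_simps mem_simps)

text \<open>Linearity gives \<open>\<psi> (a, x) = \<psi> (a, 0) + \<psi> (0, x)\<close>. The first summand is fixed by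
  stabilization and the \<open>V\<close>-component of the second by co-stabilization, so the only freedom
  left is the \<open>g\<close>-component \<open>r x\<close> of \<open>\<psi> (0, x)\<close>.\<close>

lemma stabilizing_map_is_shear:
  assumes lin: "linear_on sP (g \<times> V) sP (g \<times> V) \<psi>"
    and "stabilizes_prod g \<psi>" "costabilizes_prod g V \<psi>"
  obtains r where "linear_on s V s g r" "\<And>p. p \<in> g \<times> V \<Longrightarrow> \<psi> p = shear r p"
proof
  let ?r = "\<lambda>x. fst (\<psi> (0, x))"
  have snd: "snd (\<psi> (a, x)) = x" if "a \<in> g" "x \<in> V" for a x
    using assms(3) that by (simp add: costabilizes_prod_def)
  have add: "\<psi> (0, x + y) = \<psi> (0, x) + \<psi> (0, y)" if "x \<in> V" "y \<in> V" for x y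
    using linear_onD(2)[OF lin, of "(0, x)" "(0, y)"] that by (simp add: mem_simps)
  have sc: "\<psi> (0, s c x) = sP c (\<psi> (0, x))" if "x \<in> V" for c x
    using linear_onD(3)[OF lin, of "(0, x)" c] that by (simp add: mem_simps scale_prod)
  show "linear_on s V s g ?r"
    unfolding linear_on_def
    using linear_onD(1)[OF lin, of "(0, _)"]
    by (auto simp: add sc mem_simps scale_def mem_Times_iff)
  fix p assume "p \<in> g \<times> V"
  then obtain a x where p: "p = (a, x)" "a \<in> g" "x \<in> V" by auto
  have "\<psi> p = \<psi> (a, 0) + \<psi> (0, x)"
    using linear_onD(2)[OF lin, of "(a, 0)" "(0, x)"] p by (simp add: mem_simps)
  then show "\<psi> p = shear ?r p"
    using p assms(2) snd[of 0 x]
    by (cases "\<psi> (0, x)") (simp add: shear_def stabilizes_prod_def mem_simps)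
qed

lemma shear_linear:
  assumes "linear_on s V s g r"
  shows "linear_on sP (g \<times> V) sP (g \<times> V) (shear r)"
  using linear_onD[OF assms]
  by (auto simp: linear_on_def shear_def scale_prod mem_simps scale_right_distrib)

lemma shear_bij:
  assumes "linear_on s V s g r"
  shows "bij_betw (shear r) (g \<times> V) (g \<times> V)"
  by (rule bij_betw_byWitness[where f' = "shear (\<lambda>x. - r x)"])
    (use linear_onD(1)[OF assms] subspace_neg[OF subspace_g] in
      \<open>auto simp: shear_def mem_simps\<close>)

text \<open>The pair \<open>(0, x)\<close>, \<open>(a, 0)\<close> yields the identities for the two actions and the pair
  \<open>(0, x)\<close>, \<open>(0, y)\<close> those for the cocycle and the bracket of \<open>V\<close>. In the cocycle identity
  the term \<open>br (r x) (r y)\<close> occurs once with sign minus, from the bracket of \<open>g\<close>, and twice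
  with sign plus, from replacing \<open>lact \<Omega>'\<close> by \<open>lact \<Omega>\<close> in both of its occurrences, which
  uses anticommutativity of \<open>br\<close>. Conversely the identities give multiplicativity on
  all pairs by biadditivity and anticommutativity.\<close>

lemma shear_multiplicative_iff:
  assumes \<Omega>: "extending_datum s g V \<Omega>" and \<Omega>': "extending_datum s g V \<Omega>'"
    and r: "linear_on s V s g r"
  shows "(\<forall>p\<in>g \<times> V. \<forall>q\<in>g \<times> V. shear r (unified_bracket br \<Omega> p q) =
           unified_bracket br \<Omega>' (shear r p) (shear r q)) \<longleftrightarrow>
         cohomologous_via g br V r \<Omega> \<Omega>'" (is "?mult \<longleftrightarrow> ?via")
proof
  note simps = datum_simps[OF \<Omega>] datum_simps[OF \<Omega>'] br_simps mem_simps linear_onD(1,2)[OF r]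
    linear_on_0[OF r]
  have anti: "br (r y) (r x) = - br (r x) (r y)" if "x \<in> V" "y \<in> V" for x y
    using lie_algebra_on_anticomm[OF lie] linear_onD(1)[OF r] that by blast
  {
    assume ?mult
    then have mult: "shear r (unified_bracket br \<Omega> p q) =
        unified_bracket br \<Omega>' (shear r p) (shear r q)" if "p \<in> g \<times> V" "q \<in> g \<times> V" for p q
      using that by blast
    have act: "ract \<Omega>' x a = ract \<Omega> x a"
      "lact \<Omega>' x a = lact \<Omega> x a + r (ract \<Omega> x a) - br (r x) a" if "x \<in> V" "a \<in> g" for x a
      using mult[of "(0, x)" "(a, 0)"] that
      by (auto simp: shear_def unified_bracket_def simps eq_diff_eq add.commute)
    \<comment> \<open>The right actions agree on \<open>V \<times> g\<close>; off it both are \<open>undefined\<close>.\<close>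
    have ract: "ract \<Omega>' = ract \<Omega>"
    proof -
      have "case_prod (ract \<Omega>') = case_prod (ract \<Omega>)"
        by (rule extensionalityI[of _ "V \<times> g"])
          (use \<Omega> \<Omega>' act in \<open>auto simp: extending_datum_def\<close>)
      then show ?thesis by (metis case_prod_conv ext)
    qed
    have V: "vbr \<Omega>' x y = vbr \<Omega> x y - ract \<Omega> x (r y) + ract \<Omega> y (r x)"
      "cocyc \<Omega>' x y =
         cocyc \<Omega> x y + r (vbr \<Omega> x y) + br (r x) (r y)
         + lact \<Omega> y (r x) - lact \<Omega> x (r y)
         + r (ract \<Omega> y (r x)) - r (ract \<Omega> x (r y))" if "x \<in> V" "y \<in> V" for x y
      using mult[of "(0, x)" "(0, y)"] that
      by (simp_all add: shear_def unified_bracket_def simps act anti[of x y] algebra_simps)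
    show ?via
      unfolding cohomologous_via_def using act V ract by blast
  next
    assume ?via
    then have via: "ract \<Omega>' = ract \<Omega>"
      "\<And>a x. a \<in> g \<Longrightarrow> x \<in> V \<Longrightarrow> lact \<Omega>' x a = lact \<Omega> x a + r (ract \<Omega> x a) - br (r x) a"
      "\<And>x y. x \<in> V \<Longrightarrow> y \<in> V \<Longrightarrow> cocyc \<Omega>' x y =
         cocyc \<Omega> x y + r (vbr \<Omega> x y) + br (r x) (r y)
         + lact \<Omega> y (r x) - lact \<Omega> x (r y)
         + r (ract \<Omega> y (r x)) - r (ract \<Omega> x (r y))"
      "\<And>x y. x \<in> V \<Longrightarrow> y \<in> V \<Longrightarrow> vbr \<Omega>' x y = vbr \<Omega> x y - ract \<Omega> x (r y) + ract \<Omega> y (r x)"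
      by (auto simp: cohomologous_via_def)
    show ?mult
    proof (clarify)
      fix a x b y assume mem: "a \<in> g" "x \<in> V" "b \<in> g" "y \<in> V"
      have "br a (r y) = - br (r y) a"
        using lie_algebra_on_anticomm[OF lie] linear_onD(1)[OF r] mem by blast
      then show "shear r (unified_bracket br \<Omega> (a, x) (b, y)) =
          unified_bracket br \<Omega>' (shear r (a, x)) (shear r (b, y))"
        using mem
        by (simp add: shear_def unified_bracket_def via simps
            linear_on_diff[OF r] anti[of x y] algebra_simps)
    qed
  }
qed

lemma cohomologous_iff_iso:
  assumes \<Omega>: "extending_datum s g V \<Omega>" and \<Omega>': "extending_datum s g V \<Omega>'"
  shows "cohomologous s g br V \<Omega> \<Omega>' \<longleftrightarrow> (\<exists>\<psi>. unified_iso \<Omega> \<Omega>' \<psi>)"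
proof
  assume "cohomologous s g br V \<Omega> \<Omega>'"
  then obtain r where r: "linear_on s V s g r" and via: "cohomologous_via g br V r \<Omega> \<Omega>'"
    by (auto simp: cohomologous_iff_via)
  have "unified_iso \<Omega> \<Omega>' (shear r)"
    using shear_linear[OF r] shear_bij[OF r] shear_multiplicative_iff[OF \<Omega> \<Omega>' r] via
      linear_on_0[OF r] mem_simps(7)
    by (simp add: lie_iso_on_def stabilizes_prod_def costabilizes_prod_def shear_def)
  then show "\<exists>\<psi>. unified_iso \<Omega> \<Omega>' \<psi>" by blast
next
  assume "\<exists>\<psi>. unified_iso \<Omega> \<Omega>' \<psi>"
  then obtain \<psi> where iso: "unified_iso \<Omega> \<Omega>' \<psi>" by blast
  then obtain r where r: "linear_on s V s g r"
    and eq: "\<And>p. p \<in> g \<times> V \<Longrightarrow> \<psi> p = shear r p"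
    using stabilizing_map_is_shear by (auto simp: lie_iso_on_def)
  have "shear r (unified_bracket br \<Omega> p q) = unified_bracket br \<Omega>' (shear r p) (shear r q)"
    if "p \<in> g \<times> V" "q \<in> g \<times> V" for p q
    using iso that eq[OF that(1)] eq[OF that(2)] eq[OF unified_bracket_mem[OF \<Omega> that]]
    unfolding lie_iso_on_def by metis
  then show "cohomologous s g br V \<Omega> \<Omega>'"
    using shear_multiplicative_iff[OF \<Omega> \<Omega>' r] r by (auto simp: cohomologous_iff_via)
qed

section \<open>Transport to the ambient space\<close>

abbreviation dec :: "'e \<Rightarrow> 'e \<times> 'e" where "dec \<equiv> decompose g V"
abbreviation structs where "structs \<equiv> lie_extending_structures s g br V"
abbreviation T where "T \<equiv> transported_bracket g br V"

lemma bij_rec: "bij_betw recompose (g \<times> V) UNIV"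
  using bij_recompose[OF vector_space_axioms subspace_g complement] .

lemma dec_rec: "p \<in> g \<times> V \<Longrightarrow> dec (recompose p) = p"
  using bij_rec by (simp add: decompose_def bij_betw_def the_inv_into_f_f)

lemma rec_dec [simp]: "recompose (dec e) = e"
  using f_the_inv_into_f_bij_betw[OF bij_rec] by (simp add: decompose_def)

lemma dec_mem: "dec e \<in> g \<times> V"
  using bij_betw_apply[OF bij_betw_the_inv_into[OF bij_rec]] by (simp add: decompose_def)

lemma dec_g: "a \<in> g \<Longrightarrow> dec a = (a, 0)"
  using dec_rec[of "(a, 0)"] by (simp add: recompose_def mem_simps)

lemma dec_sum: "fst (dec e) + snd (dec e) = e"
  using rec_dec[of e] by (simp add: recompose_def split_beta)

text \<open>The transported bracket is defined so that recomposition is multiplicative. This holds for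
  any \<open>\<Omega>\<close>, whether or not its unified bracket satisfies the Lie axioms, and therefore the axioms
  can be moved in either direction between \<open>g \<times> V\<close> and \<open>E\<close>.\<close>

lemma rec_iso: "lie_iso_on sP (g \<times> V) (unified_bracket br \<Omega>) s UNIV (T \<Omega>) recompose"
  using bij_rec
  by (auto simp: lie_iso_on_def linear_on_def transported_bracket_def dec_rec)
    (auto simp: recompose_def scale_prod scale_right_distrib)

lemma dec_iso:
  assumes "extending_datum s g V \<Omega>"
  shows "lie_iso_on s UNIV (T \<Omega>) sP (g \<times> V) (unified_bracket br \<Omega>) dec"
  unfolding decompose_def
  by (rule lie_iso_on_the_inv_into[OF rec_iso])
    (use unified_bracket_mem[OF assms] in \<open>auto simp: mem_simps scale_prod\<close>)

lemma dec_linear: "linear_on s UNIV sP (g \<times> V) dec"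
proof -
  have "dec (e + e') = dec e + dec e'" for e e'
  proof -
    have "recompose (dec e + dec e') = recompose (dec e) + recompose (dec e')"
      by (simp add: recompose_def split_beta algebra_simps)
    moreover have "dec e + dec e' \<in> g \<times> V"
      using dec_mem[of e] dec_mem[of e'] by (simp add: mem_Times_iff mem_simps)
    ultimately show ?thesis using dec_rec by fastforce
  qed
  moreover have "dec (s c e) = sP c (dec e)" for c e
  proof -
    have "recompose (sP c (dec e)) = s c (recompose (dec e))"
      by (simp add: recompose_def split_beta scale_def scale_right_distrib)
    moreover have "sP c (dec e) \<in> g \<times> V"
      using dec_mem[of e] by (simp add: mem_Times_iff mem_simps scale_def)
    ultimately show ?thesis using dec_rec by fastforce
  qed
  ultimately show ?thesis using dec_mem by (simp add: linear_on_def)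
qed

text \<open>The two sides correspond by conjugation with recomposition, which turns \<open>(a, 0)\<close> into \<open>a\<close>
  and the second component into the projection along \<open>g\<close>.\<close>

lemma unified_iso_iff_structure_iso:
  assumes \<Omega>: "extending_datum s g V \<Omega>" and \<Omega>': "extending_datum s g V \<Omega>'"
  shows "(\<exists>\<psi>. unified_iso \<Omega> \<Omega>' \<psi>) \<longleftrightarrow>
    (\<exists>\<phi>. lie_iso_on s UNIV (T \<Omega>) s UNIV (T \<Omega>') \<phi> \<and>
         (\<forall>a\<in>g. \<phi> a = a) \<and> proj_along g V \<circ> \<phi> = proj_along g V)"
proof
  assume "\<exists>\<psi>. unified_iso \<Omega> \<Omega>' \<psi>"
  then obtain \<psi> where iso: "unified_iso \<Omega> \<Omega>' \<psi>" by blast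
  let ?\<phi> = "recompose \<circ> (\<psi> \<circ> dec)"
  have mem: "\<psi> (dec e) \<in> g \<times> V" for e
    using iso dec_mem linear_onD(1) unfolding lie_iso_on_def by blast
  have "lie_iso_on s UNIV (T \<Omega>) s UNIV (T \<Omega>') ?\<phi>"
    using lie_iso_on_comp[OF lie_iso_on_comp[OF dec_iso[OF \<Omega>]] rec_iso] iso by blast
  moreover have "\<forall>a\<in>g. ?\<phi> a = a"
    using iso by (simp add: stabilizes_prod_def dec_g recompose_def)
  moreover have "snd (\<psi> (dec e)) = snd (dec e)" for e
    using iso dec_mem[of e] unfolding costabilizes_prod_def by (cases "dec e") auto
  then have "proj_along g V \<circ> ?\<phi> = proj_along g V"
    by (simp add: fun_eq_iff proj_along_def dec_rec[OF mem])
  ultimately show "\<exists>\<phi>. lie_iso_on s UNIV (T \<Omega>) s UNIV (T \<Omega>') \<phi> \<and>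
         (\<forall>a\<in>g. \<phi> a = a) \<and> proj_along g V \<circ> \<phi> = proj_along g V" by blast
next
  assume "\<exists>\<phi>. lie_iso_on s UNIV (T \<Omega>) s UNIV (T \<Omega>') \<phi> \<and>
         (\<forall>a\<in>g. \<phi> a = a) \<and> proj_along g V \<circ> \<phi> = proj_along g V"
  then obtain \<phi> where iso: "lie_iso_on s UNIV (T \<Omega>) s UNIV (T \<Omega>') \<phi>"
    and stab: "\<And>a. a \<in> g \<Longrightarrow> \<phi> a = a" and costab: "proj_along g V \<circ> \<phi> = proj_along g V"
    by blast
  let ?\<psi> = "dec \<circ> (\<phi> \<circ> recompose)"
  have "lie_iso_on sP (g \<times> V) (unified_bracket br \<Omega>) sP (g \<times> V) (unified_bracket br \<Omega>') ?\<psi>"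
    using lie_iso_on_comp[OF lie_iso_on_comp[OF rec_iso iso] dec_iso[OF \<Omega>']] .
  moreover have "stabilizes_prod g ?\<psi>"
    by (simp add: stabilizes_prod_def recompose_def stab dec_g)
  moreover have "costabilizes_prod g V ?\<psi>"
    using fun_cong[OF costab] dec_rec
    by (simp add: costabilizes_prod_def proj_along_def)
  ultimately show "\<exists>\<psi>. unified_iso \<Omega> \<Omega>' \<psi>" by blast
qed

lemma transported_bracket_in_lie_structures:
  assumes "\<Omega> \<in> structs"
  shows "T \<Omega> \<in> lie_structures s g br"
proof -
  have \<Omega>: "extending_datum s g V \<Omega>" and lie\<Omega>: "lie_algebra_on sP (g \<times> V) (unified_bracket br \<Omega>)"
    using assms by (auto simp: lie_extending_structures_def)
  have "lie_algebra_on s UNIV (T \<Omega>)"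
    using lie_algebra_on_transport[OF rec_iso lie\<Omega> vector_space_axioms subspace_UNIV] .
  moreover have "T \<Omega> a b = br a b" if "a \<in> g" "b \<in> g" for a b
    using that by (simp add: transported_bracket_def dec_g unified_bracket_def recompose_def
        datum_simps[OF \<Omega>] mem_simps)
  ultimately show ?thesis by (simp add: lie_structures_def)
qed

text \<open>The value \<open>undefined\<close> off the domain makes the restricted maps extensional, as the components
  of an extending datum have to be.\<close>

definition restrict2 :: "'e set \<Rightarrow> 'e set \<Rightarrow> ('e \<Rightarrow> 'e \<Rightarrow> 'e) \<Rightarrow> 'e \<Rightarrow> 'e \<Rightarrow> 'e" where
  "restrict2 A C b = (\<lambda>x y. if x \<in> A \<and> y \<in> C then b x y else undefined)"

definition datum_of :: "('e \<Rightarrow> 'e \<Rightarrow> 'e) \<Rightarrow> 'e extdatum" where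
  "datum_of B = \<lparr>
     ract = restrict2 V g (\<lambda>x a. snd (dec (B x a))),
     lact = restrict2 V g (\<lambda>x a. fst (dec (B x a))),
     cocyc = restrict2 V V (\<lambda>x y. fst (dec (B x y))),
     vbr = restrict2 V V (\<lambda>x y. snd (dec (B x y)))\<rparr>"

lemma bilinear_on_restrict2:
  assumes B: "bilinear_on s UNIV UNIV UNIV B" and p: "linear_on s UNIV s D p"
    and A: "subspace A" and C: "subspace C"
  shows "bilinear_on s A C D (restrict2 A C (\<lambda>x y. p (B x y)))"
  using B p subspace_add[OF A] subspace_add[OF C] subspace_scale[OF A] subspace_scale[OF C]
  by (auto simp: bilinear_on_def linear_on_def restrict2_def Pi_iff)

lemma extending_datum_datum_of:
  assumes B: "bilinear_on s UNIV UNIV UNIV B"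
  shows "extending_datum s g V (datum_of B)"
proof -
  have "linear_on s UNIV s g (\<lambda>e. fst (dec e))" "linear_on s UNIV s V (\<lambda>e. snd (dec e))"
    using dec_linear by (auto simp: linear_on_def scale_def Pi_iff mem_Times_iff)
  then show ?thesis
    using bilinear_on_restrict2[OF B] subspace_g subspace_V
    by (simp add: extending_datum_def datum_of_def)
      (auto simp: extensional_def restrict2_def)
qed

text \<open>Expanding \<open>B (a + x) (b + y)\<close> and using \<open>B a y = - B y a\<close> leaves only values of \<open>B\<close> on
  \<open>g \<times> g\<close>, \<open>V \<times> g\<close> and \<open>V \<times> V\<close>; these are the pieces that the datum records.\<close>

lemma transported_bracket_datum_of:
  assumes "B \<in> lie_structures s g br"
  shows "T (datum_of B) = B"
proof (intro ext)
  fix e e'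
  have B: "lie_algebra_on s UNIV B" and ext: "\<And>a b. a \<in> g \<Longrightarrow> b \<in> g \<Longrightarrow> B a b = br a b"
    using assms by (auto simp: lie_structures_def)
  then have bil: "bilinear_on s UNIV UNIV UNIV B" by (simp add: lie_algebra_on_def)
  obtain a x b y where d: "dec e = (a, x)" "dec e' = (b, y)" by fastforce
  have mem: "a \<in> g" "x \<in> V" "b \<in> g" "y \<in> V"
    using dec_mem[of e] dec_mem[of e'] d by auto
  have e: "e = a + x" "e' = b + y"
    using dec_sum[of e] dec_sum[of e'] d by auto
  have split: "fst (dec z) = z - snd (dec z)" for z
    using dec_sum[of z] by (metis add_diff_cancel_right')
  have "T (datum_of B) e e' = br a b + B x b - B y a + B x y"
    using mem by (simp add: transported_bracket_def d unified_bracket_def recompose_def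
        datum_of_def restrict2_def split)
  also have "\<dots> = B a b + B x b + B a y + B x y"
    using mem lie_algebra_on_anticomm[OF B, of a y] by (simp add: ext)
  also have "\<dots> = B e e'"
    using bilinear_onD(2,3)[OF bil] by (simp add: e)
  finally show "T (datum_of B) e e' = B e e'" .
qed

text \<open>That the unified bracket of the datum of \<open>B\<close> satisfies the Lie axioms needs no computation:
  decomposition is an isomorphism onto it from \<open>E\<close> with the bracket \<open>B\<close>.\<close>

lemma transported_bracket_surj: "T ` structs = lie_structures s g br"
proof
  show "T ` structs \<subseteq> lie_structures s g br"
    using transported_bracket_in_lie_structures by blast
  show "lie_structures s g br \<subseteq> T ` structs"
  proof
    fix B assume B: "B \<in> lie_structures s g br"
    then have lieB: "lie_algebra_on s UNIV B" by (simp add: lie_structures_def)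
    then have dat: "extending_datum s g V (datum_of B)"
      using extending_datum_datum_of by (simp add: lie_algebra_on_def)
    have "lie_algebra_on sP (g \<times> V) (unified_bracket br (datum_of B))"
      using lie_algebra_on_transport[OF dec_iso[OF dat]] lieB p.vector_space_axioms
        subspace_Times[OF subspace_g subspace_V]
      by (simp add: transported_bracket_datum_of[OF B])
    then have "datum_of B \<in> structs"
      using dat by (simp add: lie_extending_structures_def)
    then show "B \<in> T ` structs"
      using transported_bracket_datum_of[OF B] by (metis imageI)
  qed
qed

lemma cohomologous_rel_eq_pullback:
  "cohomologous_rel s g br V =
     {(\<Omega>, \<Omega>'). \<Omega> \<in> structs \<and> \<Omega>' \<in> structs \<and>
        (T \<Omega>, T \<Omega>') \<in> lie_structures_rel s g br V}"
proof -
  have "cohomologous s g br V \<Omega> \<Omega>' \<longleftrightarrow> (T \<Omega>, T \<Omega>') \<in> lie_structures_rel s g br V"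
    if "\<Omega> \<in> structs" "\<Omega>' \<in> structs" for \<Omega> \<Omega>'
  proof -
    have "extending_datum s g V \<Omega>" "extending_datum s g V \<Omega>'"
      using that by (auto simp: lie_extending_structures_def)
    then show ?thesis
      using cohomologous_iff_iso unified_iso_iff_structure_iso
        transported_bracket_in_lie_structures that
      by (simp add: lie_structures_rel_def)
  qed
  then show ?thesis by (auto simp: cohomologous_rel_def)
qed

lemmas pullback_facts =
  equiv_lie_structures_rel transported_bracket_surj cohomologous_rel_eq_pullback

end

section \<open>Classification of the Lie structures on the ambient space\<close>

theorem mainTheorem4:
  fixes scale :: "'k::field \<Rightarrow> 'e::ab_group_add \<Rightarrow> 'e"
    and g V :: "'e set"
    and br :: "'e \<Rightarrow> 'e \<Rightarrow> 'e"
  assumes "vector_space scale"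
    and "lie_algebra_on scale g br"
    and "g \<noteq> {0}"
    and "complement_of scale g V"
  shows
    "(\<forall>\<Omega> \<in> lie_extending_structures scale g br V.
      \<forall>\<Omega>' \<in> lie_extending_structures scale g br V.
        cohomologous scale g br V \<Omega> \<Omega>' \<longleftrightarrow>
        (\<exists>\<psi>. lie_iso_on (module_prod.scale scale scale) (g \<times> V) (unified_bracket br \<Omega>)
                        (module_prod.scale scale scale) (g \<times> V) (unified_bracket br \<Omega>') \<psi> \<and>
             stabilizes_prod g \<psi> \<and> costabilizes_prod g V \<psi>)) \<and>
     equiv (lie_extending_structures scale g br V) (cohomologous_rel scale g br V) \<and>
     (\<forall>\<Omega> \<in> lie_extending_structures scale g br V.
        unified_class_map scale g br V (cohomologous_rel scale g br V `` {\<Omega>}) =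
        lie_structures_rel scale g br V `` {transported_bracket g br V \<Omega>}) \<and>
     bij_betw (unified_class_map scale g br V) (H2 scale g br V) (Extd' scale g br V)"
proof -
  interpret complemented_lie_algebra scale g br V
    using assms by (simp add: complemented_lie_algebra_def complemented_lie_algebra_axioms_def)
  have "unified_class_map scale g br V =
      (\<lambda>C. \<Union>\<Omega>\<in>C. lie_structures_rel scale g br V `` {T \<Omega>})"
    by (simp add: unified_class_map_def fun_eq_iff)
  then show ?thesis
    using cohomologous_iff_iso equiv_pullback[OF pullback_facts]
      pullback_class_map[OF pullback_facts] bij_betw_pullback_quotient[OF pullback_facts]
    by (simp add: H2_def Extd'_def lie_extending_structures_def)
qed

end
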